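(* Let $\mathfrak{X}=(X,\{R_0,R_1,R_2,R_3,R_4\})$ be a 4-class skew-symmetric association scheme with $R_3=R_2^{T}$, $R_4=R_1^{T}$ and $|X|=n$. Suppose the graph $(X,R_1\cup R_1^{T})$ is strongly regular with parameters $(n,k,\lambda,\mu)$. Put $k_1=k$ and $k_2=n-k-1$. Let the symmetrization $(X,\{R_0,R_1\cup R_1^T,R_2\cup R_2^T\})$ have character table $\begin{pmatrix}1&k_1&k_2\\1&r&t\\1&s&u\end{pmatrix}$ with multiplicities $1,m_1,m_2$ of the rows. Suppose the primitive idempotents $E_0,\dots,E_4$ of $\mathfrak X$ are ordered so that the character table $P$ of $\mathfrak{X}$ (rows $E_0,\dots,E_4$, columns $R_0,\dots,R_4$) is $$P=\begin{pmatrix}1&k_1/2&k_2/2&k_2/2&k_1/2\\1&\rho&\tau&\bar\tau&\bar\rho\\1&\sigma&\omega&\bar\omega&\bar\sigma\\1&\bar\sigma&\bar\omega&\omega&\sigma\\1&\bar\rho&\bar\tau&\tau&\rho\end{pmatrix},$$ with multiplicities $1,m_1/2,m_2/2,m_2/2,m_1/2$. For $i\in\{1,2\}$ let $B_i^{(0)}$ be the $4\times4$ matrix whose $(j,\ell)$ entry ($1\le j,\ell\le 4$) is the intersection number $p^{\ell}_{ij}$. Then: (1) If $\rho=r/2$, $\sigma=(s+\sqrt{-b})/2$, $\tau=(t+\sqrt{-z})/2$, $\omega=u/2$ with $b=nk_1/m_2$, $z=nk_2/m_1$ (type I), then $$B_1^{(0)}=\begin{pmatrix}\frac{\lambda+s}{4}&\frac{k(k-\lambda-1-u)}{4k_2}&\frac{k(k-\lambda-1-u)}{4k_2}&\frac{\lambda-3s}{4}\\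 \frac{k-\lambda-1+u}{4}&\frac{k-\mu+r}{4}&\frac{k-\mu-r}{4}&\frac{k-\lambda-1-u}{4}\\ \frac{k-\lambda-1+u}{4}&\frac{k-\mu-r}{4}&\frac{k-\mu+r}{4}&\frac{k-\lambda-1-u}{4}\\ \frac{\lambda+s}{4}&\frac{k(k-\lambda-1+u)}{4k_2}&\frac{k(k-\lambda-1+u)}{4k_2}&\frac{\lambda+s}{4}\end{pmatrix},$$ $$B_2^{(0)}=\begin{pmatrix}\frac{k-\lambda-1+u}{4}&\frac{k-\mu+r}{4}&\frac{k-\mu-r}{4}&\frac{k-\lambda-1-u}{4}\\ \frac{k_2(k-\mu-r)}{4k}&\frac{(n-2k+\mu-2)+t}{4}&\frac{(n-2k+\mu-2)-3t}{4}&\frac{k_2(k-\mu-r)}{4k}\\ \frac{k_2(k-\mu+r)}{4k}&\frac{(n-2k+\mu-2)+t}{4}&\frac{(n-2k+\mu-2)+t}{4}&\frac{k_2(k-\mu+r)}{4k}\\ \frac{k-\lambda-1-u}{4}&\frac{k-\mu+r}{4}&\frac{k-\mu-r}{4}&\frac{k-\lambda-1+u}{4}\end{pmatrix}.$$ (2) If $\rho=(r+\sqrt{-y})/2$, $\sigma=s/2$, $\tau=t/2$, $\omega=(u+\sqrt{-c})/2$ with $y=nk_1/m_1$, $c=nk_2/m_2$ (type II), then $$B_1^{(0)}=\begin{pmatrix}\frac{\lambda+r}{4}&\frac{k(k-\lambda-1-t)}{4k_2}&\frac{k(k-\lambda-1-t)}{4k_2}&\frac{\lambda-3r}{4}\\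 \frac{k-\lambda-1+t}{4}&\frac{k-\mu+s}{4}&\frac{k-\mu-s}{4}&\frac{k-\lambda-1-t}{4}\\ \frac{k-\lambda-1+t}{4}&\frac{k-\mu-s}{4}&\frac{k-\mu+s}{4}&\frac{k-\lambda-1-t}{4}\\ \frac{\lambda+r}{4}&\frac{k(k-\lambda-1+t)}{4k_2}&\frac{k(k-\lambda-1+t)}{4k_2}&\frac{\lambda+r}{4}\end{pmatrix},$$ $$B_2^{(0)}=\begin{pmatrix}\frac{k-\lambda-1+t}{4}&\frac{k-\mu+s}{4}&\frac{k-\mu-s}{4}&\frac{k-\lambda-1-t}{4}\\ \frac{k_2(k-\mu-s)}{4k}&\frac{(n-2k+\mu-2)+u}{4}&\frac{(n-2k+\mu-2)-3u}{4}&\frac{k_2(k-\mu-s)}{4k}\\ \frac{k_2(k-\mu+s)}{4k}&\frac{(n-2k+\mu-2)+u}{4}&\frac{(n-2k+\mu-2)+u}{4}&\frac{k_2(k-\mu+s)}{4k}\\ \frac{k-\lambda-1-t}{4}&\frac{k-\mu+s}{4}&\frac{k-\mu-s}{4}&\frac{k-\lambda-1+t}{4}\end{pmatrix}.$$ (3) If $\rho=(r+\sqrt{-y})/2$, $\tau=(t+\sqrt{-z})/2$, $\sigma=(s+\sqrt{-b})/2$, $\omega=(u-\sqrt{-c})/2$, where $b,c,y,z>0$ satisfy $m_1y+m_2b=nk_1$, $m_1z+m_2c=nk_2$, $m_1\sqrt{yz}-m_2\sqrt{bc}=0$ (type III), then with $\Gamma=m_1rz+m_2sc$, $\Phi=m_1r\sqrt{yz}-m_2s\sqrt{bc}$,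 $\Pi=m_1ry+m_2bs$, and writing $N_1=nk(n-2k+\lambda)$, $N_2=nk_2(n-2k+\mu)$: $$B_1^{(0)}=\begin{pmatrix}\frac{nk\lambda+\Pi}{4nk}&\frac{nk_2\mu+nk+2\Phi+\Pi}{4nk_2}&\frac{nk_2\mu+nk-2\Phi+\Pi}{4nk_2}&\frac{nk\lambda-3\Pi}{4nk}\\ \frac{nk_2\mu-nk-\Pi}{4nk}&\frac{N_1+\Gamma}{4nk_2}&\frac{N_1-\Gamma+2\Phi}{4nk_2}&\frac{nk+nk_2\mu-2\Phi+\Pi}{4nk}\\ \frac{nk_2\mu-nk-\Pi}{4nk}&\frac{N_1-\Gamma-2\Phi}{4nk_2}&\frac{N_1+\Gamma}{4nk_2}&\frac{nk+nk_2\mu+\Pi+2\Phi}{4nk}\\ \frac{nk\lambda+\Pi}{4nk}&\frac{nk_2\mu-nk-\Pi}{4nk_2}&\frac{nk_2\mu-nk-\Pi}{4nk_2}&\frac{nk\lambda+\Pi}{4nk}\end{pmatrix},$$ $$B_2^{(0)}=\begin{pmatrix}\frac{nk_2\mu-nk-\Pi}{4nk}&\frac{N_1+\Gamma}{4nk_2}&\frac{N_1-\Gamma+2\Phi}{4nk_2}&\frac{nk+nk_2\mu-2\Phi+\Pi}{4nk}\\ \frac{N_1-\Gamma-2\Phi}{4nk}&\frac{N_2-\Gamma-3nk_2}{4nk_2}&\frac{N_2+nk_2+3\Gamma}{4nk_2}&\frac{N_1+2\Phi-\Gamma}{4nk}\\ \frac{N_1+\Gamma}{4nk}&\frac{N_2-\Gamma-3nk_2}{4nk_2}&\frac{N_2-\Gamma-3nk_2}{4nk_2}&\frac{N_1+\Gamma}{4nk}\\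 \frac{nk+nk_2\mu+\Pi+2\Phi}{4nk}&\frac{N_1+\Gamma}{4nk_2}&\frac{N_1-\Gamma-2\Phi}{4nk_2}&\frac{nk_2\mu-nk-\Pi}{4nk}\end{pmatrix}.$$
   Context: A $d$-class association scheme is a pair $(X,\{R_i\}_{i=0}^d)$ where $X$ is finite, $R_0$ is the diagonal relation, the nonempty relations $R_i$ partition $X\times X$, each transpose $R_i^T=\{(y,x):(x,y)\in R_i\}$ equals some $R_{i'}$, and for all $i,j,k$ and all $(x,y)\in R_k$ the number $p^k_{ij}=|\{z\in X:(x,z)\in R_i,(z,y)\in R_j\}|$ (intersection number) depends only on $i,j,k$; the valency of $R_i$ is $k_i=p^0_{ii'}$. Schemes with at most 4 classes are commutative. The adjacency matrices $A_i$ of the $R_i$ span a commutative algebra with primitive idempotents $E_0=J/n,E_1,\dots,E_d$; $m_j=\operatorname{rank}E_j$ are the multiplicities; writing $A_i=\sum_j p_{ji}E_j$, the character table is $P=(p_{ji})$ (rows indexed by idempotents, columns by relations). A 4-class scheme is skew-symmetric if $R_0$ is its only symmetric relation, i.e. its relations are $R_0,R_1,R_2,R_2^T,R_1^T$. Its symmetrization $(X,\{R_0,R_1\cup R_1^T,R_2\cup R_2^T\})$ is a 2-class symmetric association scheme. A strongly regular graph with parameters $(n,k,\lambda,\mu)$ is a $k$-regular graph on $n$ vertices in which adjacent vertices have $\lambda$ common neighbours and distinct nonadjacent vertices have $\mu$ common neighbours. The bar denotes complex conjugation, and $\sqrt{-a}=i\sqrt a$ for $a>0$. *)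

theory Defs
  imports "HOL-Analysis.Analysis"
begin

text \<open>The vertex set \<open>X\<close> is the universe of a finite type \<open>'a\<close>, so that matrices with rows and columns
  indexed by \<open>X\<close> are those of \<^theory>\<open>HOL-Analysis.Cartesian_Space\<close>. A scheme is given by its
  relations \<open>R 0, \<dots>, R d\<close>; the values \<open>R i\<close> for \<open>i > d\<close> are irrelevant.\<close>

definition association_scheme :: "nat \<Rightarrow> (nat \<Rightarrow> ('a::finite \<times> 'a) set) \<Rightarrow> bool" where
  "association_scheme d R \<longleftrightarrow>
     R 0 = Id \<and>
     (\<forall>i\<le>d. R i \<noteq> {}) \<and> (\<Union>i\<le>d. R i) = UNIV \<and> disjoint_family_on R {..d} \<and>
     (\<forall>i\<le>d. \<exists>i'\<le>d. (R i)\<inverse> = R i') \<and>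
     (\<forall>i\<le>d. \<forall>j\<le>d. \<forall>k\<le>d. \<exists>p. \<forall>(x, y)\<in>R k. card {z. (x, z) \<in> R i \<and> (z, y) \<in> R j} = p)"

text \<open>\<open>intersection_number R i j k\<close> is \<open>p\<^sup>k\<^sub>i\<^sub>j\<close>.\<close>

definition intersection_number :: "(nat \<Rightarrow> ('a::finite \<times> 'a) set) \<Rightarrow> nat \<Rightarrow> nat \<Rightarrow> nat \<Rightarrow> nat" where
  "intersection_number R i j k =
     (THE p. \<forall>(x, y)\<in>R k. card {z. (x, z) \<in> R i \<and> (z, y) \<in> R j} = p)"

lemma intersection_number_eq:
  assumes "association_scheme d R" "i \<le> d" "j \<le> d" "k \<le> d" "(x, y) \<in> R k"
  shows "card {z. (x, z) \<in> R i \<and> (z, y) \<in> R j} = intersection_number R i j k"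
proof -
  obtain p where p: "\<forall>(x, y)\<in>R k. card {z. (x, z) \<in> R i \<and> (z, y) \<in> R j} = p"
    using assms(1-4) unfolding association_scheme_def by meson
  then have "intersection_number R i j k = p"
    unfolding intersection_number_def using assms(5) by (intro the_equality) auto
  with p assms(5) show ?thesis by auto
qed

text \<open>The matrix with \<open>(j, l)\<close> entry \<open>p\<^sup>l\<^sub>i\<^sub>j\<close> for \<open>1 \<le> j, l \<le> d\<close>, as the list of its rows.\<close>

definition intersection_matrix ::
    "nat \<Rightarrow> (nat \<Rightarrow> ('a::finite \<times> 'a) set) \<Rightarrow> nat \<Rightarrow> real list list" where
  "intersection_matrix d R i =
     map (\<lambda>j. map (\<lambda>l. real (intersection_number R i j l)) [1..<d + 1]) [1..<d + 1]"

definition skew_symmetric_scheme :: "nat \<Rightarrow> (nat \<Rightarrow> ('a::finite \<times> 'a) set) \<Rightarrow> bool" where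
  "skew_symmetric_scheme d R \<longleftrightarrow> association_scheme d R \<and> (\<forall>i\<le>d. sym (R i) \<longrightarrow> i = 0)"

text \<open>For a scheme \<open>R\<^sub>0, R\<^sub>1, R\<^sub>2, R\<^sub>2\<^sup>T, R\<^sub>1\<^sup>T\<close> the relations of the symmetrization are the
  values of this function at \<open>0, 1, 2\<close>.\<close>

definition symmetrization :: "(nat \<Rightarrow> ('a \<times> 'a) set) \<Rightarrow> nat \<Rightarrow> ('a \<times> 'a) set" where
  "symmetrization R i = R i \<union> (R i)\<inverse>"

definition strongly_regular ::
    "('a::finite \<times> 'a) set \<Rightarrow> nat \<Rightarrow> nat \<Rightarrow> nat \<Rightarrow> nat \<Rightarrow> bool" where
  "strongly_regular A n k lam mu \<longleftrightarrow>
     sym A \<and> irrefl A \<and> CARD('a) = n \<and> (\<forall>x. card (A `` {x}) = k) \<and>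
     (\<forall>x y. (x, y) \<in> A \<longrightarrow> card (A `` {x} \<inter> A `` {y}) = lam) \<and>
     (\<forall>x y. x \<noteq> y \<and> (x, y) \<notin> A \<longrightarrow> card (A `` {x} \<inter> A `` {y}) = mu)"

definition adjacency_matrix :: "('a::finite \<times> 'a) set \<Rightarrow> complex^'a^'a" where
  "adjacency_matrix A = (\<chi> x y. if (x, y) \<in> A then 1 else 0)"

definition smult_matrix :: "complex \<Rightarrow> complex^'a^'a \<Rightarrow> complex^'a^'a" where
  "smult_matrix c = map_matrix ((*) c)"

text \<open>The complex linear span of the adjacency matrices.\<close>

definition adjacency_algebra :: "nat \<Rightarrow> (nat \<Rightarrow> ('a::finite \<times> 'a) set) \<Rightarrow> (complex^'a^'a) set" where
  "adjacency_algebra d R = range (\<lambda>c. \<Sum>i\<le>d. smult_matrix (c i) (adjacency_matrix (R i)))"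

definition primitive_idempotent :: "(complex^'a^'a) set \<Rightarrow> complex^'a::finite^'a \<Rightarrow> bool" where
  "primitive_idempotent \<A> E \<longleftrightarrow>
     E \<in> \<A> \<and> E \<noteq> 0 \<and> E ** E = E \<and>
     \<not> (\<exists>F\<in>\<A>. \<exists>G\<in>\<A>. F \<noteq> 0 \<and> G \<noteq> 0 \<and> F ** F = F \<and> G ** G = G \<and>
            F ** G = 0 \<and> G ** F = 0 \<and> E = F + G)"

text \<open>\<open>E 0, \<dots>, E d\<close> lists all primitive idempotents exactly once, starting with \<open>J/n\<close>.\<close>

definition primitive_idempotents ::
    "nat \<Rightarrow> (nat \<Rightarrow> ('a::finite \<times> 'a) set) \<Rightarrow> (nat \<Rightarrow> complex^'a^'a) \<Rightarrow> bool" where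
  "primitive_idempotents d R E \<longleftrightarrow>
     bij_betw E {..d} {F. primitive_idempotent (adjacency_algebra d R) F} \<and>
     E 0 = (\<chi> x y. 1 / of_nat CARD('a))"

text \<open>\<open>P\<close> is a list of rows: \<open>P ! j ! i\<close> is the eigenvalue \<open>p\<^sub>j\<^sub>i\<close> of \<open>A\<^sub>i\<close> on \<open>E\<^sub>j\<close>.\<close>

definition character_table ::
    "nat \<Rightarrow> (nat \<Rightarrow> ('a::finite \<times> 'a) set) \<Rightarrow> (nat \<Rightarrow> complex^'a^'a) \<Rightarrow> complex list list \<Rightarrow> bool" where
  "character_table d R E P \<longleftrightarrow>
     (\<forall>i\<le>d. adjacency_matrix (R i) = (\<Sum>j\<le>d. smult_matrix (P ! j ! i) (E j)))"

definition multiplicities :: "nat \<Rightarrow> (nat \<Rightarrow> complex^'a::finite^'a) \<Rightarrow> real list" where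
  "multiplicities d E = map (\<lambda>j. real (rank (E j))) [0..<d + 1]"

end

theory Submission
  imports Defs
begin

text \<open>For relations \<open>A\<close>, \<open>B\<close>, \<open>T\<close> the trace of \<open>A ** B ** T\<^sup>T\<close> counts the triangles of the
  three relations, and by orthogonality of the idempotents it is also the sum over \<open>h\<close> of the
  multiplicity of \<open>E h\<close> times the product of the three eigenvalues. With \<open>A\<close>, \<open>B\<close>, \<open>T\<close> relations of the
  scheme this expresses the intersection numbers by the character table; with relations of the
  symmetrization it gives the power moments of \<open>k, r, s\<close> in terms of the strongly regular parameters.
  Substituting the moments yields formulas in \<open>\<Pi>\<^sub>0, \<Gamma>, \<Phi>\<close> (written \<open>P, G, Q\<close>) that hold for all three
  types: types I and II are the special cases in which two of the four imaginary parts, and hence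
  \<open>\<Phi>\<close>, vanish.\<close>

section \<open>Rank and trace of idempotent matrices, and their orthogonality\<close>

text \<open>Take a basis \<open>B\<close> of the row space, of size \<open>rank E\<close>, and let
  \<open>C\<close> collect the coordinates of the rows of \<open>E\<close> in it. Multiplication by
  an idempotent fixes its own rows, so the two factors in the reverse order give the identity matrix
  of size \<open>rank E\<close>.\<close>

lemma idempotent_factorization:
  fixes E :: "'a::field^'n^'n"
  assumes "E ** E = E"
  obtains B C where "finite B" "card B = rank E"
    and "\<And>i j. E $ i $ j = (\<Sum>b\<in>B. C b i * b $ j)"
    and "\<And>b b'. b \<in> B \<Longrightarrow> b' \<in> B \<Longrightarrow> (\<Sum>i\<in>UNIV. b $ i * C b' i) = (if b = b' then 1 else 0)"
proof -
  obtain B where B: "B \<subseteq> rows E" "vec.independent B" "rows E \<subseteq> vec.span B" "card B = vec.dim (rows E)"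
    using vec.basis_exists by blast
  have fin: "finite B"
    using B(2) by (rule vec.finiteI_independent)
  define C where "C = (\<lambda>b i. vec.representation B (E $ i) b)"
  have span: "E $ i \<in> vec.span B" for i
    using B(3) by (auto simp: rows_def row_def)
  have E: "E $ i $ j = (\<Sum>b\<in>B. C b i * b $ j)" for i j
  proof -
    have "E $ i = (\<Sum>b\<in>B. C b i *s b)"
      unfolding C_def using vec.sum_representation_eq[OF B(2) span fin] by simp
    then show ?thesis by (metis (no_types, lifting) sum.cong sum_component vector_smult_component)
  qed
  \<comment> \<open>As a row of \<open>E\<close>, the vector \<open>b\<close> times \<open>E\<close>
    is \<open>b\<close> again; the claim compares the coordinates of both sides at
    \<open>b'\<close>.\<close>
  have "(\<Sum>i\<in>UNIV. b $ i * C b' i) = (if b = b' then 1 else 0)" if b: "b \<in> B" for b b'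
  proof -
    obtain m where m: "b = E $ m"
      using b B(1) by (auto simp: rows_def row_def)
    have "(\<Sum>i\<in>UNIV. b $ i *s (E $ i)) = (E ** E) $ m"
      by (simp add: m vec_eq_iff matrix_matrix_mult_def)
    then have "b = (\<Sum>i\<in>UNIV. b $ i *s (E $ i))"
      using assms m by simp
    then have "vec.representation B b b' = (\<Sum>i\<in>UNIV. vec.representation B (b $ i *s (E $ i)) b')"
      using vec.representation_sum[OF B(2), of UNIV "\<lambda>i. b $ i *s (E $ i)"] vec.span_scale[OF span]
      by metis
    also have "\<dots> = (\<Sum>i\<in>UNIV. b $ i * C b' i)"
      by (simp add: vec.representation_scale[OF B(2) span] C_def)
    finally show ?thesis
      using vec.representation_basis[OF B(2) b] by auto
  qed
  then show ?thesis
    using that fin B(4) E by (simp add: row_rank_def_gen)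
qed

text \<open>Exchanging the two factors of the factorization keeps the trace and leaves the identity
  matrix of size \<open>rank E\<close>.\<close>

lemma trace_idempotent:
  fixes E :: "'a::field^'n^'n"
  assumes "E ** E = E"
  shows "trace E = of_nat (rank E)"
proof -
  obtain B C where "finite B" "card B = rank E"
    and E: "\<And>i j. E $ i $ j = (\<Sum>b\<in>B. C b i * b $ j)"
    and C: "\<And>b b'. b \<in> B \<Longrightarrow> b' \<in> B \<Longrightarrow> (\<Sum>i\<in>UNIV. b $ i * C b' i) = (if b = b' then 1 else 0)"
    by (rule idempotent_factorization[OF assms]) (rule that)
  have "trace E = (\<Sum>b\<in>B. \<Sum>i\<in>UNIV. b $ i * C b i)"
    unfolding trace_def E by (subst sum.swap) (simp add: mult.commute)
  also have "\<dots> = of_nat (card B)"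
    using C by simp
  finally show ?thesis
    using \<open>card B = rank E\<close> by simp
qed

lemma trace_sum: "trace (\<Sum>h\<in>S. A h) = (\<Sum>h\<in>S. trace (A h :: 'a::comm_semiring_1^'n^'n))"
  by (induction S rule: infinite_finite_induct) (simp_all add: trace_add trace_0 flip: mat_0)

text \<open>The factorizations of the idempotents are the blocks of one factorization of the identity
  matrix; it is square because the ranks add up to the trace of the identity, so its factors commute.\<close>

lemma orthogonal_idempotents:
  fixes E :: "'h \<Rightarrow> 'a::field_char_0^'n^'n"
  assumes fin: "finite H"
    and idem: "\<And>h. h \<in> H \<Longrightarrow> E h ** E h = E h"
    and one: "(\<Sum>h\<in>H. E h) = mat 1"
    and gh: "g \<in> H" "h \<in> H" "g \<noteq> h"
  shows "E g ** E h = 0"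
proof -
  have "\<forall>h\<in>H. \<exists>B C. finite B \<and> card B = rank (E h) \<and> (\<forall>i j. E h $ i $ j = (\<Sum>b\<in>B. C b i * b $ j))"
    by (intro ballI, rule idempotent_factorization[OF idem]) blast+
  then obtain B C where "\<forall>h\<in>H. finite (B h) \<and> card (B h) = rank (E h) \<and>
      (\<forall>i j. E h $ i $ j = (\<Sum>b\<in>B h. C h b i * b $ j))"
    unfolding bchoice_iff by blast
  then have B: "\<And>h. h \<in> H \<Longrightarrow> finite (B h)" "\<And>h. h \<in> H \<Longrightarrow> card (B h) = rank (E h)"
    and E: "\<And>h i j. h \<in> H \<Longrightarrow> E h $ i $ j = (\<Sum>b\<in>B h. C h b i * b $ j)"
    by blast+
  let ?S = "Sigma H B"
  \<comment> \<open>The number of basis vectors in all blocks is compared with the dimension inside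
    the field; characteristic 0 carries the equality back to natural numbers.\<close>
  have "of_nat (card ?S) = (\<Sum>h\<in>H. trace (E h))"
    using fin B by (simp add: card_SigmaI trace_idempotent[OF idem])
  also have "\<dots> = of_nat CARD('n)"
    using one trace_I by (metis trace_sum)
  finally have "card ?S = CARD('n)"
    by simp
  moreover have "finite ?S"
    using fin B(1) by blast
  ultimately obtain f where f: "bij_betw f (UNIV :: 'n set) ?S"
    by (metis finite bij_betw_iff_card)
  \<comment> \<open>\<open>M\<close> and \<open>N\<close> line up the blocks \<open>C h\<close> and
    \<open>B h\<close>. The bijection \<open>f\<close> labels the block vectors by the matrix index
    type, so both are square.\<close>
  define M where "M = (\<chi> i x. C (fst (f x)) (snd (f x)) i)"
  define N where "N = (\<chi> x j. snd (f x) $ j)"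
  have "(M ** N) $ i $ j = mat 1 $ i $ j" for i j
  proof -
    have "(M ** N) $ i $ j = (\<Sum>p\<in>?S. C (fst p) (snd p) i * snd p $ j)"
      unfolding M_def N_def matrix_matrix_mult_def
      by (simp add: sum.reindex_bij_betw[OF f, of "\<lambda>p. C (fst p) (snd p) i * snd p $ j"])
    also have "\<dots> = (\<Sum>h\<in>H. \<Sum>b\<in>B h. C h b i * b $ j)"
      using fin B(1) by (simp add: sum.Sigma case_prod_unfold)
    also have "\<dots> = (\<Sum>h\<in>H. E h) $ i $ j"
      using E by simp
    finally show ?thesis
      using one by simp
  qed
  then have "N ** M = mat 1"
    using matrix_left_right_inverse by (metis vec_eq_iff)
  then have NM: "(\<Sum>k\<in>UNIV. snd (f x) $ k * C (fst (f y)) (snd (f y)) k) = (if x = y then 1 else 0)" for x y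
    by (simp add: M_def N_def matrix_matrix_mult_def mat_def vec_eq_iff)
  \<comment> \<open>Because \<open>g \<noteq> h\<close>, the two labels differ, and the sum is an
    off-diagonal entry of \<open>N ** M = mat 1\<close>.\<close>
  have zero: "(\<Sum>k\<in>UNIV. b $ k * C h b' k) = 0" if "b \<in> B g" "b' \<in> B h" for b b'
  proof -
    have "(g, b) \<in> range f" "(h, b') \<in> range f"
      using f gh that by (auto simp: bij_betw_def)
    then obtain x y where "f x = (g, b)" "f y = (h, b')"
      by (metis rangeE)
    then show ?thesis
      using NM[of x y] gh(3) by auto
  qed
  have "(E g ** E h) $ i $ j = 0" for i j
  proof -
    have "(E g ** E h) $ i $ j =
        (\<Sum>k\<in>UNIV. \<Sum>b\<in>B g. \<Sum>b'\<in>B h. C g b i * b' $ j * (b $ k * C h b' k))"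
      by (simp add: matrix_matrix_mult_def E gh sum_product) (simp add: mult_ac)
    also have "\<dots> = (\<Sum>b\<in>B g. \<Sum>b'\<in>B h. C g b i * b' $ j * (\<Sum>k\<in>UNIV. b $ k * C h b' k))"
      by (subst sum.swap, intro sum.cong refl, subst sum.swap) (simp add: sum_distrib_left)
    finally show ?thesis
      using zero by simp
  qed
  then show ?thesis
    by (simp add: vec_eq_iff)
qed

section \<open>Spectral decompositions and traces of triple products\<close>

lemma matrix_mult_sum_left: "(\<Sum>h\<in>H. A h) ** B = (\<Sum>h\<in>H. A h ** (B :: 'a::semiring_1^'n^'m))"
  by (induction H rule: infinite_finite_induct) (simp_all add: vec_eq_iff matrix_matrix_mult_def distrib_right sum.distrib)

lemma matrix_mult_sum_right: "B ** (\<Sum>h\<in>H. A h) = (\<Sum>h\<in>H. (B :: 'a::semiring_1^'n^'m) ** A h)"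
  by (induction H rule: infinite_finite_induct) (simp_all add: matrix_add_ldistrib)

lemma smult_matrix_mult: "smult_matrix a A ** smult_matrix b B = smult_matrix (a * b) (A ** B)"
  by (simp add: smult_matrix_def matrix_matrix_mult_def vec_eq_iff sum_distrib_left mult_ac)

lemma trace_smult_matrix: "trace (smult_matrix a A) = a * trace A"
  by (simp add: smult_matrix_def trace_def sum_distrib_left)

lemma smult_matrix_0_right [simp]: "smult_matrix a 0 = 0"
  by (simp add: smult_matrix_def vec_eq_iff)

text \<open>Orthogonality kills the cross terms, so such matrices multiply eigenvalue by
  eigenvalue.\<close>

lemma spectral_mult:
  assumes "finite H" and "\<And>g h. g \<in> H \<Longrightarrow> h \<in> H \<Longrightarrow> E g ** E h = (if g = h then E g else 0)"
  shows "(\<Sum>h\<in>H. smult_matrix (a h) (E h)) ** (\<Sum>h\<in>H. smult_matrix (b h) (E h)) =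
    (\<Sum>h\<in>H. smult_matrix (a h * b h) (E h))"
proof -
  have "(\<Sum>h\<in>H. smult_matrix (a h) (E h)) ** (\<Sum>h\<in>H. smult_matrix (b h) (E h)) =
    (\<Sum>g\<in>H. \<Sum>h\<in>H. if g = h then smult_matrix (a h * b h) (E h) else 0)"
    by (auto simp: matrix_mult_sum_left matrix_mult_sum_right smult_matrix_mult assms(2) intro!: sum.cong)
  then show ?thesis
    using assms(1) by simp
qed

lemma trace_spectral_mult3:
  assumes H: "finite H" "\<And>g h. g \<in> H \<Longrightarrow> h \<in> H \<Longrightarrow> E g ** E h = (if g = h then E g else 0)"
    and "A = (\<Sum>h\<in>H. smult_matrix (a h) (E h))" "B = (\<Sum>h\<in>H. smult_matrix (b h) (E h))"
      "C = (\<Sum>h\<in>H. smult_matrix (c h) (E h))"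
  shows "trace (A ** B ** C) = (\<Sum>h\<in>H. a h * b h * c h * trace (E h))"
  unfolding assms(3-) by (simp add: spectral_mult[OF H] trace_sum trace_smult_matrix)

text \<open>The \<open>(x, y)\<close> entry of the first product counts the intermediate points
  \<open>z\<close>. Multiplying by the transpose of \<open>T\<close> and taking the trace adds these
  counts over the pairs in \<open>T\<close>, where they all equal \<open>p\<close>.\<close>

lemma trace_adjacency_triple:
  assumes "\<And>x y. (x, y) \<in> T \<Longrightarrow> card {z. (x, z) \<in> P \<and> (z, y) \<in> Q} = p"
  shows "trace (adjacency_matrix P ** adjacency_matrix Q ** adjacency_matrix (T\<inverse>)) = of_nat (p * card T)"
proof -
  have count: "(adjacency_matrix P ** adjacency_matrix Q) $ x $ y =
      of_nat (card {z. (x, z) \<in> P \<and> (z, y) \<in> Q})" for x y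
  proof -
    have "(adjacency_matrix P ** adjacency_matrix Q) $ x $ y =
        (\<Sum>z\<in>UNIV. if (x, z) \<in> P \<and> (z, y) \<in> Q then 1 else 0)"
      unfolding matrix_matrix_mult_def adjacency_matrix_def by (auto intro!: sum.cong)
    then show ?thesis
      by (simp add: sum.If_cases)
  qed
  have "trace (adjacency_matrix P ** adjacency_matrix Q ** adjacency_matrix (T\<inverse>)) =
      (\<Sum>x\<in>UNIV. \<Sum>y\<in>UNIV. (adjacency_matrix P ** adjacency_matrix Q) $ x $ y * (if (x, y) \<in> T then 1 else 0))"
    unfolding trace_def matrix_matrix_mult_def[of "_ ** _"] adjacency_matrix_def by simp
  also have "\<dots> = (\<Sum>(x, y)\<in>UNIV. if (x, y) \<in> T then of_nat p else 0)"
    by (auto simp: count assms sum.cartesian_product intro!: sum.cong)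
  also have "\<dots> = of_nat (p * card T)"
    by (simp add: case_prod_unfold sum.If_cases)
  finally show ?thesis .
qed

lemma idempotent_rank_pos:
  fixes E :: "'a::field^'n^'n"
  assumes "E ** E = E" "E \<noteq> 0"
  shows "rank E > 0"
proof (rule ccontr)
  assume "\<not> rank E > 0"
  moreover obtain B C where "finite B" "card B = rank E"
    and E: "\<And>i j. E $ i $ j = (\<Sum>b\<in>B. C b i * b $ j)"
    by (rule idempotent_factorization[OF assms(1)]) (rule that)
  ultimately have "E = 0"
    by (simp add: vec_eq_iff)
  with assms(2) show False ..
qed

lemma atMost_4: "{..4::nat} = {0, 1, 2, 3, 4}"
  by auto

section \<open>Eigenvalues occurring in conjugate pairs\<close>

text \<open>The indices 1, 4 and 2, 3 are paired: the ranks agree within each pair, and the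
  eigenvalues considered below are conjugate. Pairwise orthogonality is derived from idempotency and
  \<open>sum_one\<close>.\<close>

locale conjugate_idempotents =
  fixes E :: "nat \<Rightarrow> complex^'a::finite^'a" and m1 m2 :: real
  assumes idempotent: "h \<le> 4 \<Longrightarrow> E h ** E h = E h"
    and nonzero: "h \<le> 4 \<Longrightarrow> E h \<noteq> 0"
    and sum_one: "(\<Sum>h\<le>4. E h) = mat 1"
    and trivial_idempotent: "E 0 = (\<chi> x y. 1 / of_nat CARD('a))"
    and ranks: "multiplicities 4 E = [1, m1 / 2, m2 / 2, m2 / 2, m1 / 2]"
begin

text \<open>One predicate covers the relations of the scheme, their transposes, those of the
  symmetrization, \<open>Id\<close> and \<open>UNIV\<close>, since all their eigenvalue lists have
  this shape.\<close>

definition has_eigenvalues :: "('a \<times> 'a) set \<Rightarrow> real \<Rightarrow> complex \<Rightarrow> complex \<Rightarrow> bool" where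
  "has_eigenvalues A \<kappa> x y \<longleftrightarrow>
     adjacency_matrix A = (\<Sum>h\<le>4. smult_matrix ([of_real \<kappa>, x, y, cnj y, cnj x] ! h) (E h))"

lemma orthogonal:
  assumes "g \<le> 4" "h \<le> 4"
  shows "E g ** E h = (if g = h then E g else 0)"
  using orthogonal_idempotents[of "{..4}" E g h] idempotent sum_one assms by simp

lemma trace_E:
  "trace (E 0) = 1" "trace (E (Suc 0)) = of_real (m1 / 2)" "trace (E 2) = of_real (m2 / 2)"
  "trace (E 3) = of_real (m2 / 2)" "trace (E 4) = of_real (m1 / 2)"
proof -
  have *: "trace (E h) = of_real ([1, m1 / 2, m2 / 2, m2 / 2, m1 / 2] ! h)" if "h \<le> 4" for h
  proof -
    have "multiplicities 4 E ! h = real (rank (E h))"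
      using that by (simp add: multiplicities_def del: upt_Suc)
    then show ?thesis
      using trace_idempotent[OF idempotent[OF that]] ranks by simp
  qed
  show
    "trace (E 0) = 1" "trace (E (Suc 0)) = of_real (m1 / 2)" "trace (E 2) = of_real (m2 / 2)"
    "trace (E 3) = of_real (m2 / 2)" "trace (E 4) = of_real (m1 / 2)"
    using *[of 0] *[of 1] *[of 2] *[of 3] *[of 4] by simp_all
qed

lemma multiplicities_pos: "m1 > 0" "m2 > 0"
proof -
  have "real (rank (E 1)) = m1 / 2" "real (rank (E 2)) = m2 / 2"
    using ranks by (simp_all add: multiplicities_def upt_rec eval_nat_numeral)
  moreover have "rank (E 1) > 0" "rank (E 2) > 0"
    by (simp_all add: idempotent_rank_pos[OF idempotent nonzero])
  ultimately show "m1 > 0" "m2 > 0"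
    by linarith+
qed

lemma eigenvalues_Un:
  assumes "has_eigenvalues A \<kappa> x y" "has_eigenvalues B \<kappa>' x' y'" "A \<inter> B = {}"
  shows "has_eigenvalues (A \<union> B) (\<kappa> + \<kappa>') (x + x') (y + y')"
proof -
  have "adjacency_matrix (A \<union> B) = adjacency_matrix A + adjacency_matrix B"
    using assms(3) by (auto simp: adjacency_matrix_def vec_eq_iff)
  then show ?thesis
    using assms(1,2)
    by (simp add: has_eigenvalues_def atMost_4 smult_matrix_def vec_eq_iff algebra_simps)
qed

text \<open>Multiplication by the nonzero matrix \<open>E g\<close> isolates the coefficient at
  \<open>g\<close>.\<close>

lemma eigenvalues_unique:
  assumes "has_eigenvalues A \<kappa> x y" "has_eigenvalues A \<kappa>' x' y'"
  shows "\<kappa> = \<kappa>' \<and> x = x' \<and> y = y'"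
proof -
  have coeff: "a ! g = b ! g"
    if "(\<Sum>h\<le>4. smult_matrix (a ! h) (E h)) = (\<Sum>h\<le>4. smult_matrix (b ! h) (E h))" "g \<le> 4" for a b g
  proof -
    \<comment> \<open>The factor 1 only brings \<open>E g\<close> into the form that
      \<open>smult_matrix_mult\<close> expects.\<close>
    have *: "(\<Sum>h\<le>4. smult_matrix (c ! h) (E h)) ** smult_matrix 1 (E g) = smult_matrix (c ! g) (E g)" for c
      using that(2) by (simp add: matrix_mult_sum_left smult_matrix_mult orthogonal if_distrib cong: if_cong)
    have "smult_matrix (a ! g) (E g) = smult_matrix (b ! g) (E g)"
      using that(1) *[of a] *[of b] by simp
    then show ?thesis
      using nonzero[OF that(2)] by (auto simp: smult_matrix_def vec_eq_iff)
  qed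
  have "(\<Sum>h\<le>4. smult_matrix ([of_real \<kappa>, x, y, cnj y, cnj x] ! h) (E h)) =
      (\<Sum>h\<le>4. smult_matrix ([of_real \<kappa>', x', y', cnj y', cnj x'] ! h) (E h))"
    using assms[unfolded has_eigenvalues_def] by (rule trans[OF sym])
  from coeff[OF this, of 0] coeff[OF this, of 1] coeff[OF this, of 2] show ?thesis
    by simp
qed

lemma eigenvalues_Id: "has_eigenvalues Id 1 1 1"
proof -
  have "adjacency_matrix (Id :: ('a \<times> 'a) set) = (\<Sum>h\<le>4. E h)"
    unfolding sum_one by (simp add: adjacency_matrix_def mat_def vec_eq_iff)
  then show ?thesis
    by (simp add: has_eigenvalues_def atMost_4 smult_matrix_def vec_eq_iff)
qed

text \<open>The all-one matrix is \<open>CARD('a)\<close> times \<open>E 0\<close>.\<close>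

lemma eigenvalues_UNIV: "has_eigenvalues UNIV (real CARD('a)) 0 0"
  by (simp add: has_eigenvalues_def atMost_4 smult_matrix_def vec_eq_iff trivial_idempotent adjacency_matrix_def)

text \<open>Both sides are the trace of one triple product. Within a pair of idempotents the
  eigenvalue products are conjugate and the multiplicities are equal halves of \<open>m1\<close> or
  \<open>m2\<close>, so each pair contributes \<open>m1\<close> or \<open>m2\<close> times a real
  part.\<close>

lemma triple_count:
  assumes "has_eigenvalues A \<kappa> x y" "has_eigenvalues B \<kappa>' x' y'" "has_eigenvalues (T\<inverse>) \<kappa>'' x'' y''"
    and "\<And>v w. (v, w) \<in> T \<Longrightarrow> card {z. (v, z) \<in> A \<and> (z, w) \<in> B} = p"
  shows "real p * real (card T) = \<kappa> * \<kappa>' * \<kappa>'' + m1 * Re (x * x' * x'') + m2 * Re (y * y' * y'')"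
proof -
  have "of_nat (p * card T) = trace (adjacency_matrix A ** adjacency_matrix B ** adjacency_matrix (T\<inverse>))"
    using trace_adjacency_triple[OF assms(4)] by simp
  also have "\<dots> = (\<Sum>h\<le>4. [of_real \<kappa>, x, y, cnj y, cnj x] ! h * [of_real \<kappa>', x', y', cnj y', cnj x'] ! h *
      [of_real \<kappa>'', x'', y'', cnj y'', cnj x''] ! h * trace (E h))"
    using assms(1-3) unfolding has_eigenvalues_def
    by (intro trace_spectral_mult3) (auto simp: orthogonal)
  finally have "of_nat (p * card T) = of_real (\<kappa> * \<kappa>' * \<kappa>'')
      + of_real (m1 / 2) * (x * x' * x'' + cnj (x * x' * x''))
      + of_real (m2 / 2) * (y * y' * y'' + cnj (y * y' * y''))"
    by (simp add: atMost_4 trace_E algebra_simps)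
  moreover have "of_real (c / 2) * (w + cnj w) = complex_of_real (c * Re w)" for c w
    by (simp add: complex_add_cnj)
  ultimately have "complex_of_real (real p * real (card T)) =
      of_real (\<kappa> * \<kappa>' * \<kappa>'' + m1 * Re (x * x' * x'') + m2 * Re (y * y' * y''))"
    by (simp only: of_real_add of_real_mult of_nat_mult of_real_of_nat_eq)
  then show ?thesis
    by (simp only: of_real_eq_iff)
qed

text \<open>The triple count with \<open>Id\<close> and \<open>UNIV\<close> has exactly one
  intermediate point, and \<open>UNIV\<close> leaves only the term of \<open>E 0\<close>.\<close>

lemma card_relation:
  assumes "has_eigenvalues (T\<inverse>) \<kappa> x y"
  shows "real (card T) = real CARD('a) * \<kappa>"
proof -
  have "{z. (v, z) \<in> Id \<and> (z, w) \<in> UNIV} = {v}" for v w :: 'a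
    by auto
  then show ?thesis
    using triple_count[OF eigenvalues_Id eigenvalues_UNIV assms, of 1] by simp
qed

text \<open>All eigenvalues are written as halves to avoid fractions: the product of three gives
  1/8, while \<open>card (R l)\<close> is \<open>CARD('a) * \<kappa>\<^sub>2 / 2\<close>, hence the
  factor 4. The brackets are the real parts of the triple products, written out.\<close>

lemma intersection_number_eigenvalues:
  assumes "association_scheme 4 R" "i \<le> 4" "j \<le> 4" "l \<le> 4"
    and "has_eigenvalues (R i) (\<kappa> / 2) (Complex (a / 2) (a' / 2)) (Complex (b / 2) (b' / 2))"
    and "has_eigenvalues (R j) (\<kappa>\<^sub>1 / 2) (Complex (a\<^sub>1 / 2) (a\<^sub>1' / 2)) (Complex (b\<^sub>1 / 2) (b\<^sub>1' / 2))"
    and "has_eigenvalues ((R l)\<inverse>) (\<kappa>\<^sub>2 / 2) (Complex (a\<^sub>2 / 2) (a\<^sub>2' / 2)) (Complex (b\<^sub>2 / 2) (b\<^sub>2' / 2))"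
  shows "real (intersection_number R i j l) * (4 * real CARD('a) * \<kappa>\<^sub>2) = \<kappa> * \<kappa>\<^sub>1 * \<kappa>\<^sub>2
    + m1 * (a * a\<^sub>1 * a\<^sub>2 - a * a\<^sub>1' * a\<^sub>2' - a' * a\<^sub>1 * a\<^sub>2' - a' * a\<^sub>1' * a\<^sub>2)
    + m2 * (b * b\<^sub>1 * b\<^sub>2 - b * b\<^sub>1' * b\<^sub>2' - b' * b\<^sub>1 * b\<^sub>2' - b' * b\<^sub>1' * b\<^sub>2)"
proof -
  have "real (intersection_number R i j l) * real (card (R l)) = \<kappa> / 2 * (\<kappa>\<^sub>1 / 2) * (\<kappa>\<^sub>2 / 2)
    + m1 * Re (Complex (a / 2) (a' / 2) * Complex (a\<^sub>1 / 2) (a\<^sub>1' / 2) * Complex (a\<^sub>2 / 2) (a\<^sub>2' / 2))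
    + m2 * Re (Complex (b / 2) (b' / 2) * Complex (b\<^sub>1 / 2) (b\<^sub>1' / 2) * Complex (b\<^sub>2 / 2) (b\<^sub>2' / 2))"
    using triple_count[OF assms(5-7)] intersection_number_eq[OF assms(1-4)] by blast
  then show ?thesis
    using card_relation[OF assms(7)] by (simp add: field_simps)
qed

end

section \<open>Intersection matrices in terms of the eigenvalues\<close>

text \<open>The common source of all three types: \<alpha>, \<beta>, \<gamma>, \<delta> are twice
  the imaginary parts of \<rho>, \<sigma>, \<tau>, \<omega>. Type I is \<alpha> = \<delta> = 0, type
  II is \<beta> = \<gamma> = 0, and in type III only \<delta> is negative. The parameter facts come
  first, separately, because they help to verify the quadratic relations that the matrix formulas
  presuppose.\<close>

lemma intersection_matrices_of_eigenvalues:
  fixes R :: "nat \<Rightarrow> ('a::finite \<times> 'a) set"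
    and k' lam' mu' :: nat
    and n k lam mu k2 r s t u m1 m2 \<alpha> \<beta> \<gamma> \<delta> :: real
  assumes scheme: "association_scheme 4 R"
    and R34: "R 3 = (R 2)\<inverse>" "R 4 = (R 1)\<inverse>"
    and srg: "strongly_regular (R 1 \<union> (R 1)\<inverse>) CARD('a) k' lam' mu'"
    and n: "n = real CARD('a)" and lam: "lam = real lam'" and mu: "mu = real mu'"
    and prim: "primitive_idempotents 4 R E"
    and table: "character_table 4 R E
          [[1, of_real k / 2, of_real k2 / 2, of_real k2 / 2, of_real k / 2],
           [1, \<rho>, \<tau>, cnj \<tau>, cnj \<rho>],
           [1, \<sigma>, \<omega>, cnj \<omega>, cnj \<sigma>],
           [1, cnj \<sigma>, cnj \<omega>, \<omega>, \<sigma>],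
           [1, cnj \<rho>, cnj \<tau>, \<tau>, \<rho>]]"
    and ranks: "multiplicities 4 E = [1, m1 / 2, m2 / 2, m2 / 2, m1 / 2]"
    and \<rho>: "\<rho> = Complex (r / 2) (\<alpha> / 2)" and \<sigma>: "\<sigma> = Complex (s / 2) (\<beta> / 2)"
    and \<tau>: "\<tau> = Complex (t / 2) (\<gamma> / 2)" and \<omega>: "\<omega> = Complex (u / 2) (\<delta> / 2)"
  shows "n > 0" "k > 0" "k2 > 0" "m1 > 0" "m2 > 0" "t = - 1 - r" "u = - 1 - s" "n = 1 + k + k2"
      "k2 * mu = k * (k - lam - 1)"
    and "\<lbrakk>m1 * \<alpha>\<^sup>2 + m2 * \<beta>\<^sup>2 = n * k; m1 * \<gamma>\<^sup>2 + m2 * \<delta>\<^sup>2 = n * k2; m1 * (\<alpha> * \<gamma>) + m2 * (\<beta> * \<delta>) = 0;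
       P = m1 * r * \<alpha>\<^sup>2 + m2 * s * \<beta>\<^sup>2; G = m1 * r * \<gamma>\<^sup>2 + m2 * s * \<delta>\<^sup>2;
       Q = m1 * r * (\<alpha> * \<gamma>) + m2 * s * (\<beta> * \<delta>);
       N1 = n * k * (n - 2 * k + lam); N2 = n * k2 * (n - 2 * k + mu)\<rbrakk> \<Longrightarrow>
    intersection_matrix 4 R 1 =
      [[(n * k * lam + P) / (4 * n * k), (n * k2 * mu + n * k + 2 * Q + P) / (4 * n * k2), (n * k2 * mu + n * k - 2 * Q + P) / (4 * n * k2), (n * k * lam - 3 * P) / (4 * n * k)],
       [(n * k2 * mu - n * k - P) / (4 * n * k), (N1 + G) / (4 * n * k2), (N1 - G + 2 * Q) / (4 * n * k2), (n * k + n * k2 * mu - 2 * Q + P) / (4 * n * k)],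
       [(n * k2 * mu - n * k - P) / (4 * n * k), (N1 - G - 2 * Q) / (4 * n * k2), (N1 + G) / (4 * n * k2), (n * k + n * k2 * mu + P + 2 * Q) / (4 * n * k)],
       [(n * k * lam + P) / (4 * n * k), (n * k2 * mu - n * k - P) / (4 * n * k2), (n * k2 * mu - n * k - P) / (4 * n * k2), (n * k * lam + P) / (4 * n * k)]] \<and>
    intersection_matrix 4 R 2 =
      [[(n * k2 * mu - n * k - P) / (4 * n * k), (N1 + G) / (4 * n * k2), (N1 - G + 2 * Q) / (4 * n * k2), (n * k + n * k2 * mu - 2 * Q + P) / (4 * n * k)],
       [(N1 - G - 2 * Q) / (4 * n * k), (N2 - G - 3 * n * k2) / (4 * n * k2), (N2 + n * k2 + 3 * G) / (4 * n * k2), (N1 + 2 * Q - G) / (4 * n * k)],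
       [(N1 + G) / (4 * n * k), (N2 - G - 3 * n * k2) / (4 * n * k2), (N2 - G - 3 * n * k2) / (4 * n * k2), (N1 + G) / (4 * n * k)],
       [(n * k + n * k2 * mu + P + 2 * Q) / (4 * n * k), (N1 + G) / (4 * n * k2), (N1 - G - 2 * Q) / (4 * n * k2), (n * k2 * mu - n * k - P) / (4 * n * k)]]"
proof -
  have prim_E: "primitive_idempotent (adjacency_algebra 4 R) (E h)" if "h \<le> 4" for h
    using prim that unfolding primitive_idempotents_def bij_betw_def by blast
  have adj: "adjacency_matrix (R i) = (\<Sum>j\<le>4. smult_matrix (
          [[1, of_real k / 2, of_real k2 / 2, of_real k2 / 2, of_real k / 2],
           [1, \<rho>, \<tau>, cnj \<tau>, cnj \<rho>],
           [1, \<sigma>, \<omega>, cnj \<omega>, cnj \<sigma>],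
           [1, cnj \<sigma>, cnj \<omega>, \<omega>, \<sigma>],
           [1, cnj \<rho>, cnj \<tau>, \<tau>, \<rho>]] ! j ! i) (E j))" if "i \<le> 4" for i
    using table that unfolding character_table_def by blast
  have R0: "R 0 = Id" and nonempty: "\<And>i. i \<le> 4 \<Longrightarrow> R i \<noteq> {}"
    and cover: "(\<Union>i\<le>4. R i) = UNIV" and disj: "disjoint_family_on R {..4}"
    using scheme unfolding association_scheme_def by auto
  \<comment> \<open>The column of \<open>R 0\<close> in the table consists of ones, so the
    idempotents add up to the identity.\<close>
  have "(\<Sum>h\<le>4. E h) = adjacency_matrix (R 0)"
    unfolding adj[of 0, simplified] by (simp add: atMost_4 smult_matrix_def vec_eq_iff)
  then interpret conjugate_idempotents E m1 m2
    using prim_E prim ranks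
    by unfold_locales
      (auto simp: primitive_idempotent_def primitive_idempotents_def adjacency_matrix_def mat_def R0 vec_eq_iff)
  have rel1: "has_eigenvalues (R 1) (k / 2) (Complex (r / 2) (\<alpha> / 2)) (Complex (s / 2) (\<beta> / 2))"
    unfolding has_eigenvalues_def using adj[of 1] by (simp add: atMost_4 \<rho> \<sigma> \<tau> \<omega>)
  have rel2: "has_eigenvalues (R 2) (k2 / 2) (Complex (t / 2) (\<gamma> / 2)) (Complex (u / 2) (\<delta> / 2))"
    unfolding has_eigenvalues_def using adj[of 2] by (simp add: atMost_4 \<rho> \<sigma> \<tau> \<omega>)
  have rel3: "has_eigenvalues (R 3) (k2 / 2) (Complex (t / 2) (- \<gamma> / 2)) (Complex (u / 2) (- \<delta> / 2))"
    unfolding has_eigenvalues_def using adj[of 3] by (simp add: atMost_4 \<rho> \<sigma> \<tau> \<omega> complex_cnj)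
  have rel4: "has_eigenvalues (R 4) (k / 2) (Complex (r / 2) (- \<alpha> / 2)) (Complex (s / 2) (- \<beta> / 2))"
    unfolding has_eigenvalues_def using adj[of 4] by (simp add: atMost_4 \<rho> \<sigma> \<tau> \<omega> complex_cnj)
  \<comment> \<open>Triple counts mention the transpose of the target relation; these equations turn
    it into a relation with known eigenvalues.\<close>
  note conv = R34[symmetric] R34[THEN arg_cong[of _ _ converse], unfolded converse_converse]
  \<comment> \<open>\<open>S\<close> is the strongly regular graph and \<open>T\<close> its
    complement; the imaginary parts cancel in each union.\<close>
  define S where "S = R 1 \<union> R 4"
  define T where "T = R 2 \<union> R 3"
  have disj': "R i \<inter> R j = {}" if "i \<le> 4" "j \<le> 4" "i \<noteq> j" for i j
    using disj that unfolding disjoint_family_on_def by simp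
  have "Complex (x / 2) (y / 2) + Complex (x / 2) (- y / 2) = of_real x" for x y
    by (simp add: complex_eq_iff)
  then have eig_S: "has_eigenvalues S k (of_real r) (of_real s)"
    and eig_T: "has_eigenvalues T k2 (of_real t) (of_real u)"
    unfolding S_def T_def using eigenvalues_Un[OF rel1 rel4] eigenvalues_Un[OF rel2 rel3] disj' by simp_all
  have SS: "S\<inverse> = S" and TT: "T\<inverse> = T"
    unfolding S_def T_def R34 by auto
  have eig_SC: "has_eigenvalues (S\<inverse>) k (of_real r) (of_real s)"
    and eig_TC: "has_eigenvalues (T\<inverse>) k2 (of_real t) (of_real u)"
    unfolding SS TT by (rule eig_S eig_T)+
  have ST: "S \<inter> T = {}" and IS: "Id \<inter> S = {}" and IT: "Id \<inter> T = {}"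
    unfolding S_def T_def R0[symmetric] using disj' by (simp_all add: Int_Un_distrib Int_Un_distrib2)
  \<comment> \<open>Comparing the eigenvalues of this partition with those of the all-one matrix
    gives \<open>n\<close>, \<open>t\<close> and \<open>u\<close>.\<close>
  have "UNIV = Id \<union> (S \<union> T)"
    using cover by (auto simp: atMost_4 S_def T_def R0)
  moreover have "has_eigenvalues (Id \<union> (S \<union> T)) (1 + (k + k2)) (1 + (of_real r + of_real t)) (1 + (of_real s + of_real u))"
    using eigenvalues_Un[OF eigenvalues_Id eigenvalues_Un[OF eig_S eig_T ST]] IS IT
    by (simp add: Int_Un_distrib)
  ultimately have "n = 1 + (k + k2)" "1 + (complex_of_real r + of_real t) = 0" "1 + (complex_of_real s + of_real u) = 0"
    using eigenvalues_unique[OF eigenvalues_UNIV] unfolding n by simp_all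
  then show n_eq: "n = 1 + k + k2" and t: "t = - 1 - r" and u: "u = - 1 - s"
    by (auto simp: complex_eq_iff)
  show n_pos: "n > 0"
    unfolding n by simp
  have "real (card (R 1)) = n * (k / 2)" "real (card (R 2)) = n * (k2 / 2)"
    using card_relation[of "R 1"] card_relation[of "R 2"] rel3 rel4 unfolding n conv by blast+
  moreover have "card (R 1) > 0" "card (R 2) > 0"
    using nonempty[of 1] nonempty[of 2] by (simp_all add: card_gt_0_iff)
  ultimately have "n * k > 0" "n * k2 > 0"
    by linarith+
  then show k_pos: "k > 0" and k2_pos: "k2 > 0"
    using n_pos by (simp_all add: zero_less_mult_iff)
  show "m1 > 0" "m2 > 0"
    by (rule multiplicities_pos)+
  have card_S: "real (card S) = n * k" and card_T: "real (card T) = n * k2"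
    unfolding n by (rule card_relation[OF eig_SC] card_relation[OF eig_TC])+
  \<comment> \<open>From here on the power moments of \<open>k\<close>, \<open>r\<close>,
    \<open>s\<close>: the traces of the powers of the adjacency matrix of \<open>S\<close>. Exponent
    1 gives 0, as \<open>S\<close> has no loops.\<close>
  have "card {z. (v, z) \<in> Id \<and> (z, w) \<in> Id} = 0" if "(v, w) \<in> S" for v w
    using that IS by auto
  from triple_count[OF eigenvalues_Id eigenvalues_Id eig_SC this]
  have moment1: "k + m1 * r + m2 * s = 0"
    by simp
  have "{z. (v, z) \<in> Id \<and> (z, w) \<in> S} = {v}" if "(v, w) \<in> S" for v w
    using that by auto
  with triple_count[OF eigenvalues_Id eig_S eig_SC, of 1]
  have moment2: "k * k + m1 * r * r + m2 * s * s = n * k"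
    by (simp add: card_S)
  have "{z. (v, z) \<in> Id \<and> (z, w) \<in> Id} = {v}" if "(v, w) \<in> Id" for v w :: 'a
    using that by auto
  with triple_count[OF eigenvalues_Id eigenvalues_Id, of Id 1 1 1 1] eigenvalues_Id
    card_relation[of Id 1 1 1]
  have moment0: "1 + m1 + m2 = n"
    by (simp add: n)
  \<comment> \<open>By symmetry of \<open>S\<close>, the paths of length two are the common
    neighbours counted by the strongly regular parameters.\<close>
  have nbrs: "{z. (v, z) \<in> S \<and> (z, w) \<in> S} = S `` {v} \<inter> S `` {w}" for v w
    using SS by auto
  have srg_S: "strongly_regular S CARD('a) k' lam' mu'"
    using srg R34 by (simp add: S_def)
  then have "card {z. (v, z) \<in> S \<and> (z, w) \<in> S} = lam'" if "(v, w) \<in> S" for v w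
    using that unfolding strongly_regular_def nbrs by blast
  from triple_count[OF eig_S eig_S eig_SC this]
  have moment3: "k * k * k + m1 * r * r * r + m2 * s * s * s = n * k * lam"
    by (simp add: card_S lam mult_ac)
  have "card {z. (v, z) \<in> S \<and> (z, w) \<in> S} = mu'" if "(v, w) \<in> T" for v w
    using that srg_S ST IT unfolding strongly_regular_def nbrs by blast
  from triple_count[OF eig_S eig_S eig_TC this]
  have moment_rrt: "k * k * k2 + m1 * r * r * t + m2 * s * s * u = n * k2 * mu"
    by (simp add: card_T mu mult_ac)
  \<comment> \<open>Inserting \<open>t\<close> and \<open>u\<close> reduces
    \<open>moment_rrt\<close> to the second and third moments; the usual parameter identity appears
    multiplied by \<open>n\<close>.\<close>
  have "n * (k2 * mu) = n * (k * (k - lam - 1))"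
    using moment2 moment3 moment_rrt n_eq unfolding t u by algebra
  then show mu_eq: "k2 * mu = k * (k - lam - 1)"
    using n_pos by simp
  assume \<alpha>\<beta>: "m1 * \<alpha>\<^sup>2 + m2 * \<beta>\<^sup>2 = n * k" and \<gamma>\<delta>: "m1 * \<gamma>\<^sup>2 + m2 * \<delta>\<^sup>2 = n * k2"
    and \<alpha>\<gamma>: "m1 * (\<alpha> * \<gamma>) + m2 * (\<beta> * \<delta>) = 0"
    and P: "P = m1 * r * \<alpha>\<^sup>2 + m2 * s * \<beta>\<^sup>2" and G: "G = m1 * r * \<gamma>\<^sup>2 + m2 * s * \<delta>\<^sup>2"
    and Q: "Q = m1 * r * (\<alpha> * \<gamma>) + m2 * s * (\<beta> * \<delta>)"
    and N1: "N1 = n * k * (n - 2 * k + lam)" and N2: "N2 = n * k2 * (n - 2 * k + mu)"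
  \<comment> \<open>In the next two moments, \<open>n - 2 * k + lam\<close> and
    \<open>n - 2 * k + mu - 2\<close> are the numbers of common non-neighbours of two adjacent and
    of two distinct nonadjacent vertices; the two endpoints account for the term
    \<open>- 2 * n * k2\<close>.\<close>
  have moment_rtt: "k * k2 * k2 + m1 * r * t * t + m2 * s * u * u = N1"
    using moment1 moment2 moment3 n_eq unfolding t u N1 by algebra
  have moment_ttt: "k2 * k2 * k2 + m1 * t * t * t + m2 * u * u * u = N2 - 2 * n * k2"
    using moment0 moment1 moment2 moment3 n_eq mu_eq unfolding t u N2 by algebra
  \<comment> \<open>Replacing the real parts \<open>r\<close>, \<open>s\<close> by
    \<open>t = - 1 - r\<close>, \<open>u = - 1 - s\<close> negates \<open>P\<close>,
    \<open>G\<close>, \<open>Q\<close> and subtracts the corresponding quadratic relation, which is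
    zero for \<open>Q\<close>.\<close>
  have P_t: "m1 * \<alpha> * \<alpha> * t + m2 * \<beta> * \<beta> * u = - n * k - P"
    using \<alpha>\<beta> unfolding t u P by algebra
  have G_t: "m1 * \<gamma> * \<gamma> * t + m2 * \<delta> * \<delta> * u = - n * k2 - G"
    using \<gamma>\<delta> unfolding t u G by algebra
  have Q_t: "m1 * \<alpha> * \<gamma> * t + m2 * \<beta> * \<delta> * u = - Q"
    using \<alpha>\<gamma> unfolding t u Q by algebra
  have PGQ: "m1 * \<alpha> * \<alpha> * r + m2 * \<beta> * \<beta> * s = P" "m1 * \<gamma> * \<gamma> * r + m2 * \<delta> * \<delta> * s = G"
      "m1 * \<alpha> * \<gamma> * r + m2 * \<beta> * \<delta> * s = Q"
    unfolding P G Q by (simp_all add: power2_eq_square)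
  \<comment> \<open>Every entry expands into one product of three real parts and three products of
    one real part with two imaginary parts; this list evaluates all of them.\<close>
  note moments = moment3 moment_rrt moment_rtt moment_ttt P_t G_t Q_t PGQ
  have le4: "1 \<le> (4::nat)" "2 \<le> (4::nat)" "3 \<le> (4::nat)" "4 \<le> (4::nat)"
    by simp_all
  note entry = intersection_number_eigenvalues[OF scheme, folded n]
  \<comment> \<open>The third relation is always the transpose of \<open>R l\<close>. Two imaginary
    parts of equal sign contribute negatively, of opposite sign positively: here \<open>P\<close>
    occurs as 1 + 1 - 1, and for \<open>p114\<close>, where all signs agree, as -3.\<close>
  have p111: "real (intersection_number R 1 1 1) = (n * k * lam + P) / (4 * n * k)"
    using entry[OF le4(1) le4(1) le4(1), unfolded conv, OF rel1 rel1 rel4] moments n_pos k_pos k2_pos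
    by (simp add: eq_divide_eq algebra_simps)
  have p112: "real (intersection_number R 1 1 2) = (n * k2 * mu + n * k + 2 * Q + P) / (4 * n * k2)"
    using entry[OF le4(1) le4(1) le4(2), unfolded conv, OF rel1 rel1 rel3] moments n_pos k_pos k2_pos
    by (simp add: eq_divide_eq algebra_simps)
  have p113: "real (intersection_number R 1 1 3) = (n * k2 * mu + n * k - 2 * Q + P) / (4 * n * k2)"
    using entry[OF le4(1) le4(1) le4(3), unfolded conv, OF rel1 rel1 rel2] moments n_pos k_pos k2_pos
    by (simp add: eq_divide_eq algebra_simps)
  have p114: "real (intersection_number R 1 1 4) = (n * k * lam - 3 * P) / (4 * n * k)"
    using entry[OF le4(1) le4(1) le4(4), unfolded conv, OF rel1 rel1 rel1] moments n_pos k_pos k2_pos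
    by (simp add: eq_divide_eq algebra_simps)
  have p121: "real (intersection_number R 1 2 1) = (n * k2 * mu - n * k - P) / (4 * n * k)"
    using entry[OF le4(1) le4(2) le4(1), unfolded conv, OF rel1 rel2 rel4] moments n_pos k_pos k2_pos
    by (simp add: eq_divide_eq algebra_simps)
  have p122: "real (intersection_number R 1 2 2) = (N1 + G) / (4 * n * k2)"
    using entry[OF le4(1) le4(2) le4(2), unfolded conv, OF rel1 rel2 rel3] moments n_pos k_pos k2_pos
    by (simp add: eq_divide_eq algebra_simps)
  have p123: "real (intersection_number R 1 2 3) = (N1 - G + 2 * Q) / (4 * n * k2)"
    using entry[OF le4(1) le4(2) le4(3), unfolded conv, OF rel1 rel2 rel2] moments n_pos k_pos k2_pos
    by (simp add: eq_divide_eq algebra_simps)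
  have p124: "real (intersection_number R 1 2 4) = (n * k + n * k2 * mu - 2 * Q + P) / (4 * n * k)"
    using entry[OF le4(1) le4(2) le4(4), unfolded conv, OF rel1 rel2 rel1] moments n_pos k_pos k2_pos
    by (simp add: eq_divide_eq algebra_simps)
  have p131: "real (intersection_number R 1 3 1) = (n * k2 * mu - n * k - P) / (4 * n * k)"
    using entry[OF le4(1) le4(3) le4(1), unfolded conv, OF rel1 rel3 rel4] moments n_pos k_pos k2_pos
    by (simp add: eq_divide_eq algebra_simps)
  have p132: "real (intersection_number R 1 3 2) = (N1 - G - 2 * Q) / (4 * n * k2)"
    using entry[OF le4(1) le4(3) le4(2), unfolded conv, OF rel1 rel3 rel3] moments n_pos k_pos k2_pos
    by (simp add: eq_divide_eq algebra_simps)
  have p133: "real (intersection_number R 1 3 3) = (N1 + G) / (4 * n * k2)"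
    using entry[OF le4(1) le4(3) le4(3), unfolded conv, OF rel1 rel3 rel2] moments n_pos k_pos k2_pos
    by (simp add: eq_divide_eq algebra_simps)
  have p134: "real (intersection_number R 1 3 4) = (n * k + n * k2 * mu + P + 2 * Q) / (4 * n * k)"
    using entry[OF le4(1) le4(3) le4(4), unfolded conv, OF rel1 rel3 rel1] moments n_pos k_pos k2_pos
    by (simp add: eq_divide_eq algebra_simps)
  have p141: "real (intersection_number R 1 4 1) = (n * k * lam + P) / (4 * n * k)"
    using entry[OF le4(1) le4(4) le4(1), unfolded conv, OF rel1 rel4 rel4] moments n_pos k_pos k2_pos
    by (simp add: eq_divide_eq algebra_simps)
  have p142: "real (intersection_number R 1 4 2) = (n * k2 * mu - n * k - P) / (4 * n * k2)"
    using entry[OF le4(1) le4(4) le4(2), unfolded conv, OF rel1 rel4 rel3] moments n_pos k_pos k2_pos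
    by (simp add: eq_divide_eq algebra_simps)
  have p143: "real (intersection_number R 1 4 3) = (n * k2 * mu - n * k - P) / (4 * n * k2)"
    using entry[OF le4(1) le4(4) le4(3), unfolded conv, OF rel1 rel4 rel2] moments n_pos k_pos k2_pos
    by (simp add: eq_divide_eq algebra_simps)
  have p144: "real (intersection_number R 1 4 4) = (n * k * lam + P) / (4 * n * k)"
    using entry[OF le4(1) le4(4) le4(4), unfolded conv, OF rel1 rel4 rel1] moments n_pos k_pos k2_pos
    by (simp add: eq_divide_eq algebra_simps)
  have p211: "real (intersection_number R 2 1 1) = (n * k2 * mu - n * k - P) / (4 * n * k)"
    using entry[OF le4(2) le4(1) le4(1), unfolded conv, OF rel2 rel1 rel4] moments n_pos k_pos k2_pos
    by (simp add: eq_divide_eq algebra_simps)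
  have p212: "real (intersection_number R 2 1 2) = (N1 + G) / (4 * n * k2)"
    using entry[OF le4(2) le4(1) le4(2), unfolded conv, OF rel2 rel1 rel3] moments n_pos k_pos k2_pos
    by (simp add: eq_divide_eq algebra_simps)
  have p213: "real (intersection_number R 2 1 3) = (N1 - G + 2 * Q) / (4 * n * k2)"
    using entry[OF le4(2) le4(1) le4(3), unfolded conv, OF rel2 rel1 rel2] moments n_pos k_pos k2_pos
    by (simp add: eq_divide_eq algebra_simps)
  have p214: "real (intersection_number R 2 1 4) = (n * k + n * k2 * mu - 2 * Q + P) / (4 * n * k)"
    using entry[OF le4(2) le4(1) le4(4), unfolded conv, OF rel2 rel1 rel1] moments n_pos k_pos k2_pos
    by (simp add: eq_divide_eq algebra_simps)
  have p221: "real (intersection_number R 2 2 1) = (N1 - G - 2 * Q) / (4 * n * k)"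
    using entry[OF le4(2) le4(2) le4(1), unfolded conv, OF rel2 rel2 rel4] moments n_pos k_pos k2_pos
    by (simp add: eq_divide_eq algebra_simps)
  have p222: "real (intersection_number R 2 2 2) = (N2 - G - 3 * n * k2) / (4 * n * k2)"
    using entry[OF le4(2) le4(2) le4(2), unfolded conv, OF rel2 rel2 rel3] moments n_pos k_pos k2_pos
    by (simp add: eq_divide_eq algebra_simps)
  \<comment> \<open>Three equal signs give -3 times the value in \<open>G_t\<close>, that is
    \<open>3 * n * k2 + 3 * G\<close>, to be added to \<open>N2 - 2 * n * k2\<close>.\<close>
  have p223: "real (intersection_number R 2 2 3) = (N2 + n * k2 + 3 * G) / (4 * n * k2)"
    using entry[OF le4(2) le4(2) le4(3), unfolded conv, OF rel2 rel2 rel2] moments n_pos k_pos k2_pos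
    by (simp add: eq_divide_eq algebra_simps)
  have p224: "real (intersection_number R 2 2 4) = (N1 + 2 * Q - G) / (4 * n * k)"
    using entry[OF le4(2) le4(2) le4(4), unfolded conv, OF rel2 rel2 rel1] moments n_pos k_pos k2_pos
    by (simp add: eq_divide_eq algebra_simps)
  have p231: "real (intersection_number R 2 3 1) = (N1 + G) / (4 * n * k)"
    using entry[OF le4(2) le4(3) le4(1), unfolded conv, OF rel2 rel3 rel4] moments n_pos k_pos k2_pos
    by (simp add: eq_divide_eq algebra_simps)
  have p232: "real (intersection_number R 2 3 2) = (N2 - G - 3 * n * k2) / (4 * n * k2)"
    using entry[OF le4(2) le4(3) le4(2), unfolded conv, OF rel2 rel3 rel3] moments n_pos k_pos k2_pos
    by (simp add: eq_divide_eq algebra_simps)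
  have p233: "real (intersection_number R 2 3 3) = (N2 - G - 3 * n * k2) / (4 * n * k2)"
    using entry[OF le4(2) le4(3) le4(3), unfolded conv, OF rel2 rel3 rel2] moments n_pos k_pos k2_pos
    by (simp add: eq_divide_eq algebra_simps)
  have p234: "real (intersection_number R 2 3 4) = (N1 + G) / (4 * n * k)"
    using entry[OF le4(2) le4(3) le4(4), unfolded conv, OF rel2 rel3 rel1] moments n_pos k_pos k2_pos
    by (simp add: eq_divide_eq algebra_simps)
  have p241: "real (intersection_number R 2 4 1) = (n * k + n * k2 * mu + P + 2 * Q) / (4 * n * k)"
    using entry[OF le4(2) le4(4) le4(1), unfolded conv, OF rel2 rel4 rel4] moments n_pos k_pos k2_pos
    by (simp add: eq_divide_eq algebra_simps)
  have p242: "real (intersection_number R 2 4 2) = (N1 + G) / (4 * n * k2)"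
    using entry[OF le4(2) le4(4) le4(2), unfolded conv, OF rel2 rel4 rel3] moments n_pos k_pos k2_pos
    by (simp add: eq_divide_eq algebra_simps)
  have p243: "real (intersection_number R 2 4 3) = (N1 - G - 2 * Q) / (4 * n * k2)"
    using entry[OF le4(2) le4(4) le4(3), unfolded conv, OF rel2 rel4 rel2] moments n_pos k_pos k2_pos
    by (simp add: eq_divide_eq algebra_simps)
  have p244: "real (intersection_number R 2 4 4) = (n * k2 * mu - n * k - P) / (4 * n * k)"
    using entry[OF le4(2) le4(4) le4(4), unfolded conv, OF rel2 rel4 rel1] moments n_pos k_pos k2_pos
    by (simp add: eq_divide_eq algebra_simps)
  have indices: "[1..<4 + 1] = [1, 2, 3, 4::nat]"
    by (simp add: upt_rec eval_nat_numeral)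
  show "intersection_matrix 4 R 1 =
      [[(n * k * lam + P) / (4 * n * k), (n * k2 * mu + n * k + 2 * Q + P) / (4 * n * k2), (n * k2 * mu + n * k - 2 * Q + P) / (4 * n * k2), (n * k * lam - 3 * P) / (4 * n * k)],
       [(n * k2 * mu - n * k - P) / (4 * n * k), (N1 + G) / (4 * n * k2), (N1 - G + 2 * Q) / (4 * n * k2), (n * k + n * k2 * mu - 2 * Q + P) / (4 * n * k)],
       [(n * k2 * mu - n * k - P) / (4 * n * k), (N1 - G - 2 * Q) / (4 * n * k2), (N1 + G) / (4 * n * k2), (n * k + n * k2 * mu + P + 2 * Q) / (4 * n * k)],
       [(n * k * lam + P) / (4 * n * k), (n * k2 * mu - n * k - P) / (4 * n * k2), (n * k2 * mu - n * k - P) / (4 * n * k2), (n * k * lam + P) / (4 * n * k)]] \<and>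
    intersection_matrix 4 R 2 =
      [[(n * k2 * mu - n * k - P) / (4 * n * k), (N1 + G) / (4 * n * k2), (N1 - G + 2 * Q) / (4 * n * k2), (n * k + n * k2 * mu - 2 * Q + P) / (4 * n * k)],
       [(N1 - G - 2 * Q) / (4 * n * k), (N2 - G - 3 * n * k2) / (4 * n * k2), (N2 + n * k2 + 3 * G) / (4 * n * k2), (N1 + 2 * Q - G) / (4 * n * k)],
       [(N1 + G) / (4 * n * k), (N2 - G - 3 * n * k2) / (4 * n * k2), (N2 - G - 3 * n * k2) / (4 * n * k2), (N1 + G) / (4 * n * k)],
       [(n * k + n * k2 * mu + P + 2 * Q) / (4 * n * k), (N1 + G) / (4 * n * k2), (N1 - G - 2 * Q) / (4 * n * k2), (n * k2 * mu - n * k - P) / (4 * n * k)]]"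
    unfolding intersection_matrix_def indices list.map
      p111 p112 p113 p114 p121 p122 p123 p124 p131 p132 p133 p134 p141 p142 p143 p144 p211 p212 p213 p214 p221 p222 p223 p224 p231 p232 p233 p234 p241 p242 p243 p244
    by (intro conjI refl)
qed

section \<open>Simplification for types I and II\<close>

text \<open>One computation serves both types, with \<open>(p, q, v, w)\<close> equal to
  \<open>(s, r, u, t)\<close> in type I and to \<open>(r, s, t, u)\<close> in type II. The imaginary
  parts for \<open>R 1\<close> live on one pair of idempotents and those for \<open>R 2\<close> on
  the other, so \<open>P\<close> and \<open>G\<close> are multiples of single eigenvalues and
  \<open>Q\<close> vanishes.\<close>

lemma intersection_matrices_unmixed:
  fixes n k k2 lam mu p q v w P G Q N1 N2 :: real
  assumes "n > 0" "k > 0" "k2 > 0" "n = 1 + k + k2" "k2 * mu = k * (k - lam - 1)" "v = - 1 - p" "w = - 1 - q"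
    and "P = n * k * p" "G = n * k2 * q" "Q = 0"
    and "N1 = n * k * (n - 2 * k + lam)" "N2 = n * k2 * (n - 2 * k + mu)"
    and "A\<^sub>1 =
      [[(n * k * lam + P) / (4 * n * k), (n * k2 * mu + n * k + 2 * Q + P) / (4 * n * k2), (n * k2 * mu + n * k - 2 * Q + P) / (4 * n * k2), (n * k * lam - 3 * P) / (4 * n * k)],
       [(n * k2 * mu - n * k - P) / (4 * n * k), (N1 + G) / (4 * n * k2), (N1 - G + 2 * Q) / (4 * n * k2), (n * k + n * k2 * mu - 2 * Q + P) / (4 * n * k)],
       [(n * k2 * mu - n * k - P) / (4 * n * k), (N1 - G - 2 * Q) / (4 * n * k2), (N1 + G) / (4 * n * k2), (n * k + n * k2 * mu + P + 2 * Q) / (4 * n * k)],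
       [(n * k * lam + P) / (4 * n * k), (n * k2 * mu - n * k - P) / (4 * n * k2), (n * k2 * mu - n * k - P) / (4 * n * k2), (n * k * lam + P) / (4 * n * k)]] \<and>
    A\<^sub>2 =
      [[(n * k2 * mu - n * k - P) / (4 * n * k), (N1 + G) / (4 * n * k2), (N1 - G + 2 * Q) / (4 * n * k2), (n * k + n * k2 * mu - 2 * Q + P) / (4 * n * k)],
       [(N1 - G - 2 * Q) / (4 * n * k), (N2 - G - 3 * n * k2) / (4 * n * k2), (N2 + n * k2 + 3 * G) / (4 * n * k2), (N1 + 2 * Q - G) / (4 * n * k)],
       [(N1 + G) / (4 * n * k), (N2 - G - 3 * n * k2) / (4 * n * k2), (N2 - G - 3 * n * k2) / (4 * n * k2), (N1 + G) / (4 * n * k)],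
       [(n * k + n * k2 * mu + P + 2 * Q) / (4 * n * k), (N1 + G) / (4 * n * k2), (N1 - G - 2 * Q) / (4 * n * k2), (n * k2 * mu - n * k - P) / (4 * n * k)]]"
  shows "A\<^sub>1 =
      [[(lam + p) / 4, (k * (k - lam - 1 - v)) / (4 * k2), (k * (k - lam - 1 - v)) / (4 * k2), (lam - 3 * p) / 4],
           [(k - lam - 1 + v) / 4, (k - mu + q) / 4, (k - mu - q) / 4, (k - lam - 1 - v) / 4],
           [(k - lam - 1 + v) / 4, (k - mu - q) / 4, (k - mu + q) / 4, (k - lam - 1 - v) / 4],
           [(lam + p) / 4, (k * (k - lam - 1 + v)) / (4 * k2), (k * (k - lam - 1 + v)) / (4 * k2), (lam + p) / 4]] \<and>
    A\<^sub>2 =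
      [[(k - lam - 1 + v) / 4, (k - mu + q) / 4, (k - mu - q) / 4, (k - lam - 1 - v) / 4],
           [(k2 * (k - mu - q)) / (4 * k), ((n - 2 * k + mu - 2) + w) / 4, ((n - 2 * k + mu - 2) - 3 * w) / 4, (k2 * (k - mu - q)) / (4 * k)],
           [(k2 * (k - mu + q)) / (4 * k), ((n - 2 * k + mu - 2) + w) / 4, ((n - 2 * k + mu - 2) + w) / 4, (k2 * (k - mu + q)) / (4 * k)],
           [(k - lam - 1 - v) / 4, (k - mu + q) / 4, (k - mu - q) / 4, (k - lam - 1 + v) / 4]]"
proof -
  have nz: "4 * n * k \<noteq> 0" "4 * n * k2 \<noteq> 0" "4 * k2 \<noteq> 0" "4 * k \<noteq> 0" "(4::real) \<noteq> 0"
    using assms(1-3) by simp_all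
  show ?thesis
    unfolding conjunct1[OF assms(13)] conjunct2[OF assms(13)]
    \<comment> \<open>Entry by entry, cross-multiplication leaves polynomial identities that follow
      from the parameter relations.\<close>
    by (intro conjI arg_cong2[where f = Cons] refl;
        subst frac_eq_eq, rule nz, rule nz, insert assms(4-12), algebra)
qed

theorem theorem2p2:
  fixes R :: "nat \<Rightarrow> ('a::finite \<times> 'a) set"
    and E F :: "nat \<Rightarrow> complex^'a^'a"
    and k' lam' mu' :: nat
    and n k lam mu k1 k2 r s t u m1 m2 :: real
    and \<rho> \<sigma> \<tau> \<omega> :: complex
  assumes "skew_symmetric_scheme 4 R"
    and "R 3 = (R 2)\<inverse>" and "R 4 = (R 1)\<inverse>"
    and "strongly_regular (R 1 \<union> (R 1)\<inverse>) CARD('a) k' lam' mu'"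
    and "n = real CARD('a)" and "k = real k'" and "lam = real lam'" and "mu = real mu'"
    and "k1 = k" and "k2 = n - k - 1"
    and "primitive_idempotents 2 (symmetrization R) F"
    and "character_table 2 (symmetrization R) F
          [[1, of_real k1, of_real k2],
           [1, of_real r, of_real t],
           [1, of_real s, of_real u]]"
    and "multiplicities 2 F = [1, m1, m2]"
    and "primitive_idempotents 4 R E"
    and "character_table 4 R E
          [[1, of_real k1 / 2, of_real k2 / 2, of_real k2 / 2, of_real k1 / 2],
           [1, \<rho>, \<tau>, cnj \<tau>, cnj \<rho>],
           [1, \<sigma>, \<omega>, cnj \<omega>, cnj \<sigma>],
           [1, cnj \<sigma>, cnj \<omega>, \<omega>, \<sigma>],
           [1, cnj \<rho>, cnj \<tau>, \<tau>, \<rho>]]"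
    and "multiplicities 4 E = [1, m1 / 2, m2 / 2, m2 / 2, m1 / 2]"
  shows
    "(\<forall>(b::real) (z::real).
        b = n * k1 / m2 \<and> z = n * k2 / m1 \<and>
        \<rho> = of_real r / 2 \<and> \<sigma> = (of_real s + \<i> * of_real (sqrt b)) / 2 \<and>
        \<tau> = (of_real t + \<i> * of_real (sqrt z)) / 2 \<and> \<omega> = of_real u / 2 \<longrightarrow>
        intersection_matrix 4 R 1 =
          [[(lam + s) / 4, (k * (k - lam - 1 - u)) / (4 * k2), (k * (k - lam - 1 - u)) / (4 * k2), (lam - 3 * s) / 4],
           [(k - lam - 1 + u) / 4, (k - mu + r) / 4, (k - mu - r) / 4, (k - lam - 1 - u) / 4],
           [(k - lam - 1 + u) / 4, (k - mu - r) / 4, (k - mu + r) / 4, (k - lam - 1 - u) / 4],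
           [(lam + s) / 4, (k * (k - lam - 1 + u)) / (4 * k2), (k * (k - lam - 1 + u)) / (4 * k2), (lam + s) / 4]] \<and>
        intersection_matrix 4 R 2 =
          [[(k - lam - 1 + u) / 4, (k - mu + r) / 4, (k - mu - r) / 4, (k - lam - 1 - u) / 4],
           [(k2 * (k - mu - r)) / (4 * k), ((n - 2 * k + mu - 2) + t) / 4, ((n - 2 * k + mu - 2) - 3 * t) / 4, (k2 * (k - mu - r)) / (4 * k)],
           [(k2 * (k - mu + r)) / (4 * k), ((n - 2 * k + mu - 2) + t) / 4, ((n - 2 * k + mu - 2) + t) / 4, (k2 * (k - mu + r)) / (4 * k)],
           [(k - lam - 1 - u) / 4, (k - mu + r) / 4, (k - mu - r) / 4, (k - lam - 1 + u) / 4]])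
     \<and>
     (\<forall>(y::real) (c::real).
        y = n * k1 / m1 \<and> c = n * k2 / m2 \<and>
        \<rho> = (of_real r + \<i> * of_real (sqrt y)) / 2 \<and> \<sigma> = of_real s / 2 \<and>
        \<tau> = of_real t / 2 \<and> \<omega> = (of_real u + \<i> * of_real (sqrt c)) / 2 \<longrightarrow>
        intersection_matrix 4 R 1 =
          [[(lam + r) / 4, (k * (k - lam - 1 - t)) / (4 * k2), (k * (k - lam - 1 - t)) / (4 * k2), (lam - 3 * r) / 4],
           [(k - lam - 1 + t) / 4, (k - mu + s) / 4, (k - mu - s) / 4, (k - lam - 1 - t) / 4],
           [(k - lam - 1 + t) / 4, (k - mu - s) / 4, (k - mu + s) / 4, (k - lam - 1 - t) / 4],
           [(lam + r) / 4, (k * (k - lam - 1 + t)) / (4 * k2), (k * (k - lam - 1 + t)) / (4 * k2), (lam + r) / 4]] \<and>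
        intersection_matrix 4 R 2 =
          [[(k - lam - 1 + t) / 4, (k - mu + s) / 4, (k - mu - s) / 4, (k - lam - 1 - t) / 4],
           [(k2 * (k - mu - s)) / (4 * k), ((n - 2 * k + mu - 2) + u) / 4, ((n - 2 * k + mu - 2) - 3 * u) / 4, (k2 * (k - mu - s)) / (4 * k)],
           [(k2 * (k - mu + s)) / (4 * k), ((n - 2 * k + mu - 2) + u) / 4, ((n - 2 * k + mu - 2) + u) / 4, (k2 * (k - mu + s)) / (4 * k)],
           [(k - lam - 1 - t) / 4, (k - mu + s) / 4, (k - mu - s) / 4, (k - lam - 1 + t) / 4]])
     \<and>
     (\<forall>(b::real) (c::real) (y::real) (z::real).
        b > 0 \<and> c > 0 \<and> y > 0 \<and> z > 0 \<and>
        m1 * y + m2 * b = n * k1 \<and> m1 * z + m2 * c = n * k2 \<and>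
        m1 * sqrt (y * z) - m2 * sqrt (b * c) = 0 \<and>
        \<rho> = (of_real r + \<i> * of_real (sqrt y)) / 2 \<and> \<tau> = (of_real t + \<i> * of_real (sqrt z)) / 2 \<and>
        \<sigma> = (of_real s + \<i> * of_real (sqrt b)) / 2 \<and> \<omega> = (of_real u - \<i> * of_real (sqrt c)) / 2 \<longrightarrow>
        (let \<Gamma> = m1 * r * z + m2 * s * c;
             \<Phi> = m1 * r * sqrt (y * z) - m2 * s * sqrt (b * c);
             \<Pi>\<^sub>0 = m1 * r * y + m2 * b * s;
             N1 = n * k * (n - 2 * k + lam);
             N2 = n * k2 * (n - 2 * k + mu)
         in
          intersection_matrix 4 R 1 =
            [[(n * k * lam + \<Pi>\<^sub>0) / (4 * n * k), (n * k2 * mu + n * k + 2 * \<Phi> + \<Pi>\<^sub>0) / (4 * n * k2), (n * k2 * mu + n * k - 2 * \<Phi> + \<Pi>\<^sub>0) / (4 * n * k2), (n * k * lam - 3 * \<Pi>\<^sub>0) / (4 * n * k)],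
             [(n * k2 * mu - n * k - \<Pi>\<^sub>0) / (4 * n * k), (N1 + \<Gamma>) / (4 * n * k2), (N1 - \<Gamma> + 2 * \<Phi>) / (4 * n * k2), (n * k + n * k2 * mu - 2 * \<Phi> + \<Pi>\<^sub>0) / (4 * n * k)],
             [(n * k2 * mu - n * k - \<Pi>\<^sub>0) / (4 * n * k), (N1 - \<Gamma> - 2 * \<Phi>) / (4 * n * k2), (N1 + \<Gamma>) / (4 * n * k2), (n * k + n * k2 * mu + \<Pi>\<^sub>0 + 2 * \<Phi>) / (4 * n * k)],
             [(n * k * lam + \<Pi>\<^sub>0) / (4 * n * k), (n * k2 * mu - n * k - \<Pi>\<^sub>0) / (4 * n * k2), (n * k2 * mu - n * k - \<Pi>\<^sub>0) / (4 * n * k2), (n * k * lam + \<Pi>\<^sub>0) / (4 * n * k)]] \<and>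
          intersection_matrix 4 R 2 =
            [[(n * k2 * mu - n * k - \<Pi>\<^sub>0) / (4 * n * k), (N1 + \<Gamma>) / (4 * n * k2), (N1 - \<Gamma> + 2 * \<Phi>) / (4 * n * k2), (n * k + n * k2 * mu - 2 * \<Phi> + \<Pi>\<^sub>0) / (4 * n * k)],
             [(N1 - \<Gamma> - 2 * \<Phi>) / (4 * n * k), (N2 - \<Gamma> - 3 * n * k2) / (4 * n * k2), (N2 + n * k2 + 3 * \<Gamma>) / (4 * n * k2), (N1 + 2 * \<Phi> - \<Gamma>) / (4 * n * k)],
             [(N1 + \<Gamma>) / (4 * n * k), (N2 - \<Gamma> - 3 * n * k2) / (4 * n * k2), (N2 - \<Gamma> - 3 * n * k2) / (4 * n * k2), (N1 + \<Gamma>) / (4 * n * k)],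
             [(n * k + n * k2 * mu + \<Pi>\<^sub>0 + 2 * \<Phi>) / (4 * n * k), (N1 + \<Gamma>) / (4 * n * k2), (N1 - \<Gamma> - 2 * \<Phi>) / (4 * n * k2), (n * k2 * mu - n * k - \<Pi>\<^sub>0) / (4 * n * k)]]))"
proof -
  have scheme: "association_scheme 4 R"
    using assms(1) by (simp add: skew_symmetric_scheme_def)
  note core = intersection_matrices_of_eigenvalues[OF scheme assms(2-5,7,8,14)
      assms(15)[unfolded assms(9)] assms(16)]
  show ?thesis
  proof (intro conjI[OF _ conjI] allI impI, goal_cases)
    case (1 b z)
    have "\<rho> = Complex (r / 2) (0 / 2)" "\<sigma> = Complex (s / 2) (sqrt b / 2)"
      "\<tau> = Complex (t / 2) (sqrt z / 2)" "\<omega> = Complex (u / 2) (0 / 2)"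
      using 1 by (simp_all add: complex_eq_iff)
    note core = core[OF this]
    \<comment> \<open>Nonnegativity makes the squares of the square roots equal to \<open>b\<close>
      and \<open>z\<close>; the two equations are the quadratic relations with \<alpha> = \<delta> =
      0.\<close>
    have "b \<ge> 0" "z \<ge> 0" "m2 * b = n * k" "m1 * z = n * k2"
      using 1 core(1-5) by (simp_all add: assms(9))
    note bz = this
    show ?case
      \<comment> \<open>The reflexivity facts fix \<open>P\<close>, \<open>G\<close>,
        \<open>Q\<close>, \<open>N1\<close>, \<open>N2\<close> at their simplified values; what
        remains are the premises of \<open>core(10)\<close>.\<close>
      by (rule intersection_matrices_unmixed[OF core(1-3,8,9,7,6) refl refl refl refl refl core(10)])
        (use bz in \<open>simp_all add: mult_ac\<close>)
  next
    case (2 y c)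
    have "\<rho> = Complex (r / 2) (sqrt y / 2)" "\<sigma> = Complex (s / 2) (0 / 2)"
      "\<tau> = Complex (t / 2) (0 / 2)" "\<omega> = Complex (u / 2) (sqrt c / 2)"
      using 2 by (simp_all add: complex_eq_iff)
    note core = core[OF this]
    have "y \<ge> 0" "c \<ge> 0" "m1 * y = n * k" "m2 * c = n * k2"
      using 2 core(1-5) by (simp_all add: assms(9))
    note yc = this
    show ?case
      by (rule intersection_matrices_unmixed[OF core(1-3,8,9,6,7) refl refl refl refl refl core(10)])
        (use yc in \<open>simp_all add: mult_ac\<close>)
  next
    case (3 b c y z)
    \<comment> \<open>The negative imaginary part of \<omega> produces the minus sign before
      \<open>m2\<close> in the mixed relation and in \<Phi>.\<close>
    have "\<rho> = Complex (r / 2) (sqrt y / 2)" "\<sigma> = Complex (s / 2) (sqrt b / 2)"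
      "\<tau> = Complex (t / 2) (sqrt z / 2)" "\<omega> = Complex (u / 2) (- sqrt c / 2)"
      using 3 by (simp_all add: complex_eq_iff)
    note core = core[OF this]
    show ?case
      unfolding Let_def
      by (rule core(10)) (use 3 in \<open>simp_all add: assms(9) real_sqrt_mult\<close>)
  qed
qed

end
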